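(* Let $k$ be a field. (1) For every positive integer $n$, $\operatorname{dc}(\operatorname{hoperm}_n) \leq 3^n$. (2) For every composition $\mathbf{m}=(m_1,\dots,m_n)$ of a positive integer $\gamma$, $\operatorname{dc}(\operatorname{mperm}_{\mathbf{m}}) \leq \left(\prod_{i=1}^n (m_i+1)\right) - 1$.
   Context: The determinantal complexity $\operatorname{dc}(f)$ of a polynomial $f(x_1,\dots,x_N)$ over $k$ is the minimum $m$ such that there is an $m\times m$ matrix whose entries are affine linear functions of $x_1,\dots,x_N$ with determinant equal to $f$. The hyperoctahedral permanent $\operatorname{hoperm}_n$ is the polynomial in the $2n^2$ variables $x_{i,j}$ ($1\le i\le n$, $j\in\{\pm1,\dots,\pm n\}$) given by $\operatorname{hoperm}_n=\sum_{\sigma\in S_n}\sum_{(\epsilon_1,\dots,\epsilon_n)\in\{\pm1\}^n}\prod_{i=1}^n x_{i,\epsilon_i\sigma(i)}$. For a composition $\mathbf{m}=(m_1,\dots,m_n)$ of $\gamma$ (i.e. $m_i$ positive integers with $m_1+\dots+m_n=\gamma$), the multipermanent is $\operatorname{mperm}_{\mathbf{m}}=\sum_{\sigma\in\Sigma_{\mathbf{m}}}\prod_{i=1}^{\gamma} x_{i,\sigma(i)}$, a polynomial in the variables $x_{i,j}$ ($1\le i\le\gamma$, $1\le j\le n$), where $\Sigma_{\mathbf{m}}$ is the set of functions $\sigma:\{1,\dots,\gamma\}\to\{1,\dots,n\}$ with $|\sigma^{-1}(j)|=m_j$ for $j=1,\dots,n$. *)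

theory Defs
  imports
    "HOL-Library.Poly_Mapping"
    "HOL-Library.Extended_Nat"
    "HOL-Library.FuncSet"
    "HOL-Combinatorics.Permutations"
    "Jordan_Normal_Form.Determinant"
begin

text \<open>
  Polynomials are formal: finitely supported maps from monomials (exponent maps) to
  coefficients, with the convolution product of \<open>Poly_Mapping\<close>. (Polynomial functions would be
  too coarse over finite fields.)
\<close>

type_synonym ('v, 'k) mpoly = "('v \<Rightarrow>\<^sub>0 nat) \<Rightarrow>\<^sub>0 'k"

definition Const :: "'k :: zero \<Rightarrow> ('v, 'k) mpoly" where
  "Const c = Poly_Mapping.single 0 c"

definition Var :: "'v \<Rightarrow> ('v, 'k :: zero_neq_one) mpoly" where
  "Var v = Poly_Mapping.single (Poly_Mapping.single v 1) 1"

definition affine_linear :: "'v set \<Rightarrow> ('v, 'k :: field) mpoly \<Rightarrow> bool" where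
  "affine_linear V p \<longleftrightarrow> (\<exists>c a. p = Const c + (\<Sum>v\<in>V. Const (a v) * Var v))"

text \<open>
  The finite set \<open>V\<close> consists of the variables of the ambient polynomial ring of \<open>f\<close>; matrix
  entries may use no others. The value would be \<open>\<infinity>\<close> if there were no representation at all,
  so an upper bound on it always entails that a matrix exists. The infimum of a nonempty set
  of type \<open>enat\<close> is its minimum.
\<close>

definition dc :: "'v set \<Rightarrow> ('v, 'k :: field) mpoly \<Rightarrow> enat" where
  "dc V f = Inf {enat m |m. m > 0 \<and>
     (\<exists>A \<in> carrier_mat m m. (\<forall>i<m. \<forall>j<m. affine_linear V (A $$ (i, j))) \<and> det A = f)}"

definition hoperm_vars :: "nat \<Rightarrow> (nat \<times> int) set" where
  "hoperm_vars n = {1..n} \<times> ({- int n..int n} - {0})"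

definition hoperm :: "nat \<Rightarrow> (nat \<times> int, 'k :: field) mpoly" where
  "hoperm n = (\<Sum>\<sigma> | \<sigma> permutes {1..n}. \<Sum>\<epsilon> \<in> {1..n} \<rightarrow>\<^sub>E {1, - 1}.
     \<Prod>i = 1..n. Var (i, \<epsilon> i * int (\<sigma> i)))"

text \<open>
  A composition \<open>(m\<^sub>1, \<dots>, m\<^sub>n)\<close> is given by \<open>n\<close> and a function \<open>m\<close>, of which only the values on
  \<open>{1..n}\<close> matter.
\<close>

definition composition :: "nat \<Rightarrow> nat \<Rightarrow> (nat \<Rightarrow> nat) \<Rightarrow> bool" where
  "composition \<gamma> n m \<longleftrightarrow> (\<forall>i \<in> {1..n}. m i > 0) \<and> (\<Sum>i = 1..n. m i) = \<gamma>"

definition mperm_maps :: "nat \<Rightarrow> nat \<Rightarrow> (nat \<Rightarrow> nat) \<Rightarrow> (nat \<Rightarrow> nat) set" where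
  "mperm_maps \<gamma> n m =
     {\<sigma> \<in> {1..\<gamma>} \<rightarrow>\<^sub>E {1..n}. \<forall>j \<in> {1..n}. card {i \<in> {1..\<gamma>}. \<sigma> i = j} = m j}"

definition mperm_vars :: "nat \<Rightarrow> nat \<Rightarrow> (nat \<times> nat) set" where
  "mperm_vars \<gamma> n = {1..\<gamma>} \<times> {1..n}"

definition mperm :: "nat \<Rightarrow> nat \<Rightarrow> (nat \<Rightarrow> nat) \<Rightarrow> (nat \<times> nat, 'k :: field) mpoly" where
  "mperm \<gamma> n m = (\<Sum>\<sigma> \<in> mperm_maps \<gamma> n m. \<Prod>i = 1..\<gamma>. Var (i, \<sigma> i))"

end

(*
Grenet's construction. Let the tuples v with 0 <= v_j <= m_j be the vertices of a directed graph
with an edge from u to u + e_k of weight x_{|u|+1,k}. Paths from 0 to m correspond to the maps in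
Sigma_m, so the path-weight sum P(v) from 0 to v is a multipermanent. With U the strictly upper
triangular weight matrix (vertices sorted by |v|), the row vector P satisfies P (1 - U) = e_0, and
Cramer's rule exhibits P(m), up to sign, as the determinant of 1 - U without its last row and first
column. The hyperoctahedral permanent is the permanent of the linear forms x_{i,j} + x_{i,-j},
which is the case m = (1,...,1) and gives even the bound 2^n - 1.
*)
theory Submission
  imports Defs
begin

section \<open>Path sums of acyclic weights as determinants\<close>

text \<open>Cramer's rule for \<open>p M = e_0\<close>, argued without inverses so that it holds
  over any commutative ring: replacing the last row of \<open>M\<close> by \<open>p M\<close>
  multiplies the determinant by \<open>p N\<close>, and expanding along the new last row leaves a
  single minor.\<close>

lemma det_mat_delete_unitriangular:
  fixes M :: "'a :: comm_ring_1 mat"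
  assumes M: "M \<in> carrier_mat (Suc N) (Suc N)"
    and ut: "upper_triangular M"
    and diag: "\<And>i. i \<le> N \<Longrightarrow> M $$ (i, i) = 1"
    and p: "\<And>j. j \<le> N \<Longrightarrow> (\<Sum>i\<le>N. p i * M $$ (i, j)) = (if j = 0 then 1 else 0)"
  shows "det (mat_delete M N 0) = (- 1) ^ N * p N"
proof -
  \<comment> \<open>The identity matrix with its last row replaced by \<open>p\<close>. Left
    multiplication by \<open>E\<close> keeps all rows of \<open>M\<close> except the last, which
    becomes \<open>p M = e_0\<close>.\<close>
  define E where "E = mat (Suc N) (Suc N)
    (\<lambda>(i, j). if i = N then p j else if i = j then 1 else (0 :: 'a))"
  have E: "E \<in> carrier_mat (Suc N) (Suc N)"
    by (simp add: E_def)
  have EM: "E * M \<in> carrier_mat (Suc N) (Suc N)"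
    using E M by simp
  have "det E = prod_list (diag_mat E)"
    by (rule det_lower_triangular[OF _ E]) (auto simp: E_def)
  also have "\<dots> = (\<Prod>i<Suc N. E $$ (i, i))"
    using E by (simp only: prod_list_diag_prod carrier_matD atLeast0LessThan)
  also have "\<dots> = p N"
    by (simp add: E_def)
  finally have det_E: "det E = p N" .
  have "det M = prod_list (diag_mat M)"
    by (rule det_upper_triangular[OF ut M])
  also have "\<dots> = (\<Prod>i<Suc N. M $$ (i, i))"
    using M by (simp only: prod_list_diag_prod carrier_matD atLeast0LessThan)
  also have "\<dots> = 1"
    using diag by (intro prod.neutral) auto
  finally have det_EM: "det (E * M) = p N"
    using det_mult[OF E M] det_E by simp
  have EM_row: "(E * M) $$ (i, j) = (\<Sum>k\<le>N. E $$ (i, k) * M $$ (k, j))"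
    if "i \<le> N" "j \<le> N" for i j
    using that E M by (simp add: scalar_prod_def atLeast0LessThan lessThan_Suc_atMost)
  have last: "(E * M) $$ (N, j) = (if j = 0 then 1 else 0)" if "j \<le> N" for j
    using that EM_row[of N j] p[of j] by (simp add: E_def)
  have other: "(E * M) $$ (i, j) = M $$ (i, j)" if "i < N" "j \<le> N" for i j
  proof -
    have "(E * M) $$ (i, j) = (\<Sum>k\<le>N. E $$ (i, k) * M $$ (k, j))"
      using that by (intro EM_row) auto
    also have "\<dots> = (\<Sum>k\<le>N. if k = i then M $$ (k, j) else 0)"
      using that by (intro sum.cong) (auto simp: E_def)
    finally show ?thesis using that by simp
  qed
  \<comment> \<open>The two matrices differ only in row \<open>N\<close>, which is deleted.\<close>
  have del: "mat_delete (E * M) N 0 = mat_delete M N 0"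
    using E M by (intro eq_matI) (auto simp: mat_delete_def other simp del: index_mult_mat(1))
  have "p N = (\<Sum>j<Suc N. (E * M) $$ (N, j) * cofactor (E * M) N j)"
    using det_EM laplace_expansion_row[OF EM, of N] by simp
  also have "\<dots> = (\<Sum>j<Suc N. if j = 0 then cofactor (E * M) N j else 0)"
    using last by (intro sum.cong) auto
  also have "\<dots> = (- 1) ^ N * det (mat_delete M N 0)"
    by (simp add: cofactor_def del del: sum.lessThan_Suc)
  finally have "(- 1) ^ N * p N = ((- 1) ^ N * (- 1) ^ N) * det (mat_delete M N 0)"
    by (simp only: mult.assoc)
  then show ?thesis
    by (simp flip: power_mult_distrib)
qed

text \<open>Sorting the vertices by \<open>rank\<close> makes \<open>1 - W\<close> upper
  unitriangular, with \<open>s\<close> first and \<open>t\<close> last, and \<open>P_rec\<close>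
  says that \<open>P\<close> solves \<open>P (1 - W) = e_0\<close>. The set \<open>L\<close> is an
  additive group containing 1; it later becomes the set of affine linear polynomials.\<close>

lemma determinant_of_acyclic_weights:
  fixes W :: "'b \<Rightarrow> 'b \<Rightarrow> 'a :: comm_ring_1" and rank :: "'b \<Rightarrow> nat"
  assumes fin: "finite S" and S: "s \<in> S" "t \<in> S" and st: "s \<noteq> t"
    and s_min: "\<And>v. v \<in> S - {s} \<Longrightarrow> rank s < rank v"
    and t_max: "\<And>v. v \<in> S - {t} \<Longrightarrow> rank v < rank t"
    and W_rank: "\<And>u v. W u v \<noteq> 0 \<Longrightarrow> rank u < rank v"
    and P_s: "P s = 1"
    and P_rec: "\<And>v. v \<in> S - {s} \<Longrightarrow> P v = (\<Sum>u\<in>S. P u * W u v)"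
    and L: "0 \<in> L" "1 \<in> L" "\<And>x y. x \<in> L \<Longrightarrow> y \<in> L \<Longrightarrow> x - y \<in> L"
    and W_L: "\<And>u v. u \<in> S \<Longrightarrow> v \<in> S \<Longrightarrow> W u v \<in> L"
  shows "\<exists>A \<in> carrier_mat (card S - 1) (card S - 1).
    (\<forall>i < card S - 1. \<forall>j < card S - 1. A $$ (i, j) \<in> L) \<and> det A = P t"
proof -
  obtain xs0 where xs0: "distinct xs0" "set xs0 = S"
    using finite_distinct_list[OF fin] by blast
  define xs where "xs = sort_key rank xs0"
  have xs: "distinct xs" "set xs = S" "sorted (map rank xs)"
    using xs0 by (simp_all add: xs_def)
  define N where "N = card S - 1"
  \<comment> \<open>Two distinct vertices give \<open>N > 0\<close>, so the matrix has a row 0 into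
    which the sign can be absorbed below.\<close>
  have "card {s, t} \<le> card S"
    using fin S by (intro card_mono) auto
  then have cS: "card S = Suc N" and N0: "0 < N"
    using st by (auto simp: N_def)
  have len: "length xs = Suc N"
    using xs cS distinct_card by fastforce
  define b where "b = (!) xs"
  have b_bij: "bij_betw b {..N} S"
    using bij_betw_nth[OF xs(1)] len xs(2) by (simp add: b_def lessThan_Suc_atMost)
  have b_S: "b i \<in> S" if "i \<le> N" for i
    using that b_bij by (auto simp: bij_betw_def)
  have b_mono: "rank (b i) \<le> rank (b j)" if "i \<le> j" "j \<le> N" for i j
    using that sorted_nth_mono[OF xs(3), of i j] len by (simp add: b_def)
  have b_inj: "i = j" if "b i = b j" "i \<le> N" "j \<le> N" for i j
    using that b_bij by (auto simp: bij_betw_def dest: inj_onD)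
  have b_surj: "\<exists>i\<le>N. b i = v" if "v \<in> S" for v
    using that b_bij by (auto simp: bij_betw_def)
  have b0: "b 0 = s"
  proof (rule ccontr)
    assume "b 0 \<noteq> s"
    moreover obtain i where "i \<le> N" "b i = s" using b_surj S by blast
    ultimately show False using s_min[of "b 0"] b_S[of 0] b_mono[of 0 i] by auto
  qed
  have bN: "b N = t"
  proof (rule ccontr)
    assume "b N \<noteq> t"
    moreover obtain i where "i \<le> N" "b i = t" using b_surj S by blast
    ultimately show False using t_max[of "b N"] b_S[of N] b_mono[of i N] by auto
  qed
  define M where "M = mat (Suc N) (Suc N) (\<lambda>(i, j). (if i = j then 1 else 0) - W (b i) (b j))"
  have M: "M \<in> carrier_mat (Suc N) (Suc N)"
    by (simp add: M_def)
  \<comment> \<open>Ties in \<open>rank\<close> do no harm, since nonzero weights increase the rank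
    strictly.\<close>
  have W0: "W (b i) (b j) = 0" if "j \<le> i" "i \<le> N" for i j
    using W_rank[of "b i" "b j"] b_mono[OF that] by fastforce
  have "det (mat_delete M N 0) = (- 1) ^ N * P (b N)"
  proof (rule det_mat_delete_unitriangular[OF M, where p = "\<lambda>i. P (b i)"])
    show "upper_triangular M"
      by (auto simp: M_def W0)
    show "M $$ (i, i) = 1" if "i \<le> N" for i
      using that by (simp add: M_def W0)
    show "(\<Sum>i\<le>N. P (b i) * M $$ (i, j)) = (if j = 0 then 1 else 0)" if j: "j \<le> N" for j
    proof -
      have "(\<Sum>i\<le>N. P (b i) * M $$ (i, j)) =
          (\<Sum>i\<le>N. (if i = j then P (b i) else 0) - P (b i) * W (b i) (b j))"
        using j by (intro sum.cong) (auto simp: M_def algebra_simps)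
      also have "\<dots> = P (b j) - (\<Sum>i\<le>N. P (b i) * W (b i) (b j))"
        using j by (simp add: sum_subtractf)
      also have "(\<Sum>i\<le>N. P (b i) * W (b i) (b j)) = (\<Sum>u\<in>S. P u * W u (b j))"
        by (rule sum.reindex_bij_betw[OF b_bij])
      also have "P (b j) - \<dots> = (if j = 0 then 1 else 0)"
      proof (cases "j = 0")
        case True
        \<comment> \<open>No edge enters the vertex of least rank.\<close>
        have "W u s = 0" if "u \<in> S" for u
          using that s_min[of u] W_rank[of u s] by (cases "u = s") fastforce+
        then show ?thesis using True by (simp add: b0 P_s)
      next
        case False
        then have "b j \<in> S - {s}"
          using b_S[OF j] b_inj[of j 0] b0 j by auto
        then show ?thesis using P_rec False by simp
      qed
      finally show ?thesis .
    qed
  qed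
  then have det: "det (mat_delete M N 0) = (- 1) ^ N * P t"
    by (simp add: bN)
  \<comment> \<open>Scaling one row by the sign turns the minor into exactly \<open>P t\<close>; the
    entries stay in \<open>L\<close>, which is closed under negation.\<close>
  define A where "A = multrow 0 ((- 1) ^ N) (mat_delete M N 0)"
  have D: "mat_delete M N 0 \<in> carrier_mat N N"
    using mat_delete_carrier[OF M] by simp
  have "det A = ((- 1) ^ N * (- 1) ^ N) * P t"
    using N0 by (simp add: A_def det_multrow[OF _ D] det mult.assoc)
  then have "det A = P t"
    by (simp flip: power_mult_distrib)
  moreover have "A \<in> carrier_mat N N"
    using D by (simp add: A_def)
  moreover have "A $$ (i, j) \<in> L" if "i < N" "j < N" for i j
  proof -
    have neg: "- x \<in> L" if "x \<in> L" for x
      using L(3)[OF L(1) that] by simp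
    have "mat_delete M N 0 $$ (i, j) = M $$ (i, Suc j)"
      using that M by (simp add: mat_delete_def)
    also have "\<dots> \<in> L"
      using that by (auto simp: M_def intro!: L neg W_L b_S)
    finally have "mat_delete M N 0 $$ (i, j) \<in> L" .
    moreover have "(- 1) ^ N * x \<in> L" if "x \<in> L" for x
      using that neg by (cases "even N") auto
    ultimately show ?thesis
      using that carrier_matD[OF D] by (cases "i = 0") (simp_all add: A_def)
  qed
  ultimately show ?thesis
    unfolding N_def by blast
qed

section \<open>Multipermanents over a commutative ring\<close>

text \<open>Arbitrary ring elements as entries cover both variables (for \<open>mperm\<close>) and
  sums of two variables (for \<open>hoperm\<close>). Multiplicities may be zero, as the expansion
  along the last row requires.\<close>

definition multipermanent :: "(nat \<Rightarrow> nat \<Rightarrow> 'a :: comm_ring_1) \<Rightarrow> nat \<Rightarrow> nat \<Rightarrow> (nat \<Rightarrow> nat) \<Rightarrow> 'a"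
  where "multipermanent x \<gamma> n m = (\<Sum>\<sigma>\<in>mperm_maps \<gamma> n m. \<Prod>i = 1..\<gamma>. x i (\<sigma> i))"

lemma mperm_maps_cong:
  "(\<And>j. j \<in> {1..n} \<Longrightarrow> m j = m' j) \<Longrightarrow> mperm_maps \<gamma> n m = mperm_maps \<gamma> n m'"
  by (simp add: mperm_maps_def)

lemma finite_mperm_maps: "finite (mperm_maps \<gamma> n m)"
  by (rule finite_subset[of _ "{1..\<gamma>} \<rightarrow>\<^sub>E {1..n}"]) (auto simp: mperm_maps_def intro: finite_PiE)

lemma multipermanent_0:
  assumes "\<And>j. j \<in> {1..n} \<Longrightarrow> m j = 0"
  shows "multipermanent x 0 n m = 1"
proof -
  \<comment> \<open>The domain \<open>{1..0}\<close> is empty, so the only extensional map is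
    undefined everywhere.\<close>
  have "mperm_maps 0 n m = {\<lambda>_. undefined}"
    using assms by (auto simp: mperm_maps_def)
  then show ?thesis by (simp add: multipermanent_def)
qed

lemma card_fiber_fun_upd_Suc:
  "card {i \<in> {1..Suc \<gamma>}. (\<sigma>(Suc \<gamma> := k)) i = j} =
    card {i \<in> {1..\<gamma>}. \<sigma> i = j} + (if j = k then 1 else 0)"
proof (cases "j = k")
  case True
  then have "{i \<in> {1..Suc \<gamma>}. (\<sigma>(Suc \<gamma> := k)) i = j} = insert (Suc \<gamma>) {i \<in> {1..\<gamma>}. \<sigma> i = j}"
    by auto
  then show ?thesis using True by simp
next
  case False
  then have "{i \<in> {1..Suc \<gamma>}. (\<sigma>(Suc \<gamma> := k)) i = j} = {i \<in> {1..\<gamma>}. \<sigma> i = j}"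
    by auto
  then show ?thesis using False by simp
qed

lemma fun_upd_mem_mperm_maps:
  assumes "k \<in> {1..n}" "m k > 0" "\<sigma> \<in> mperm_maps \<gamma> n (m(k := m k - 1))"
  shows "\<sigma>(Suc \<gamma> := k) \<in> mperm_maps (Suc \<gamma>) n m"
  using assms unfolding mperm_maps_def mem_Collect_eq card_fiber_fun_upd_Suc
  by (auto simp: PiE_iff extensional_def le_Suc_eq)

text \<open>Inverse direction to \<open>fun_upd_mem_mperm_maps\<close>; together they give the
  bijection behind \<open>multipermanent_Suc\<close>.\<close>

lemma restrict_mem_mperm_maps:
  assumes "\<sigma> \<in> mperm_maps (Suc \<gamma>) n m"
  defines "k \<equiv> \<sigma> (Suc \<gamma>)"
  shows "k \<in> {1..n}" "m k > 0" "restrict \<sigma> {1..\<gamma>} \<in> mperm_maps \<gamma> n (m(k := m k - 1))"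
    "(restrict \<sigma> {1..\<gamma>})(Suc \<gamma> := k) = \<sigma>"
proof -
  show k: "k \<in> {1..n}"
    using assms by (auto simp: mperm_maps_def PiE_iff)
  show upd: "(restrict \<sigma> {1..\<gamma>})(Suc \<gamma> := k) = \<sigma>"
    using assms by (fastforce simp: mperm_maps_def PiE_iff extensional_def le_Suc_eq)
  have m: "m j = card {i \<in> {1..\<gamma>}. restrict \<sigma> {1..\<gamma>} i = j} + (if j = k then 1 else 0)"
    if "j \<in> {1..n}" for j
    using assms(1) that card_fiber_fun_upd_Suc[of \<gamma> "restrict \<sigma> {1..\<gamma>}" k j]
    by (simp only: upd) (simp add: mperm_maps_def)
  show "m k > 0"
    using m[OF k] by simp
  have "restrict \<sigma> {1..\<gamma>} \<in> {1..\<gamma>} \<rightarrow>\<^sub>E {1..n}"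
    using assms by (auto simp: mperm_maps_def PiE_iff)
  then show "restrict \<sigma> {1..\<gamma>} \<in> mperm_maps \<gamma> n (m(k := m k - 1))"
    using m unfolding mperm_maps_def by (simp del: restrict_apply)
qed

text \<open>Expansion along the last row: the maps are sorted by their value \<open>k\<close> at
  \<open>Suc \<gamma>\<close>. The condition \<open>m k > 0\<close> matters, because truncated
  subtraction would otherwise leave \<open>m\<close> unchanged and add spurious terms.\<close>

lemma multipermanent_Suc:
  "multipermanent x (Suc \<gamma>) n m =
    (\<Sum>k \<in> {k \<in> {1..n}. m k > 0}. multipermanent x \<gamma> n (m(k := m k - 1)) * x (Suc \<gamma>) k)"
proof -
  have "(\<Sum>k \<in> {k \<in> {1..n}. m k > 0}. multipermanent x \<gamma> n (m(k := m k - 1)) * x (Suc \<gamma>) k) =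
    (\<Sum>(k, \<sigma>) \<in> (SIGMA k:{k \<in> {1..n}. m k > 0}. mperm_maps \<gamma> n (m(k := m k - 1))).
      (\<Prod>i = 1..\<gamma>. x i (\<sigma> i)) * x (Suc \<gamma>) k)"
    by (simp add: multipermanent_def sum_distrib_right sum.Sigma finite_mperm_maps)
  also have "\<dots> = (\<Sum>\<sigma>\<in>mperm_maps (Suc \<gamma>) n m. \<Prod>i = 1..Suc \<gamma>. x i (\<sigma> i))"
  proof (rule sum.reindex_bij_witness[where
        i = "\<lambda>\<sigma>. (\<sigma> (Suc \<gamma>), restrict \<sigma> {1..\<gamma>})" and j = "\<lambda>(k, \<sigma>). \<sigma>(Suc \<gamma> := k)"])
    fix a assume a: "a \<in> (SIGMA k:{k \<in> {1..n}. m k > 0}. mperm_maps \<gamma> n (m(k := m k - 1)))"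
    obtain k \<sigma> where [simp]: "a = (k, \<sigma>)" by fastforce
    have \<sigma>: "\<sigma> \<in> extensional {1..\<gamma>}"
      using a by (auto simp: mperm_maps_def PiE_iff)
    show "(case a of (k, \<sigma>) \<Rightarrow> \<sigma>(Suc \<gamma> := k)) \<in> mperm_maps (Suc \<gamma>) n m"
      using a fun_upd_mem_mperm_maps by auto
    show "((case a of (k, \<sigma>) \<Rightarrow> \<sigma>(Suc \<gamma> := k)) (Suc \<gamma>),
        restrict (case a of (k, \<sigma>) \<Rightarrow> \<sigma>(Suc \<gamma> := k)) {1..\<gamma>}) = a"
      using \<sigma> by (auto simp: fun_eq_iff extensional_def)
    show "(\<Prod>i = 1..Suc \<gamma>. x i ((case a of (k, \<sigma>) \<Rightarrow> \<sigma>(Suc \<gamma> := k)) i)) =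
        (case a of (k, \<sigma>) \<Rightarrow> (\<Prod>i = 1..\<gamma>. x i (\<sigma> i)) * x (Suc \<gamma>) k)"
      by simp
  next
    fix \<sigma> assume "\<sigma> \<in> mperm_maps (Suc \<gamma>) n m"
    note * = restrict_mem_mperm_maps[OF this]
    show "(case (\<sigma> (Suc \<gamma>), restrict \<sigma> {1..\<gamma>}) of (k, \<sigma>) \<Rightarrow> \<sigma>(Suc \<gamma> := k)) = \<sigma>"
      using *(4) by simp
    show "(\<sigma> (Suc \<gamma>), restrict \<sigma> {1..\<gamma>}) \<in>
        (SIGMA k:{k \<in> {1..n}. m k > 0}. mperm_maps \<gamma> n (m(k := m k - 1)))"
      using * by simp
  qed
  finally show ?thesis
    by (simp add: multipermanent_def)
qed

section \<open>Grenet's graph for a multipermanent\<close>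

lemma determinant_of_multipermanent:
  fixes x :: "nat \<Rightarrow> nat \<Rightarrow> 'a :: comm_ring_1"
  assumes pos: "\<gamma> > 0" and comp: "composition \<gamma> n m"
    and L: "0 \<in> L" "1 \<in> L" "\<And>x y. x \<in> L \<Longrightarrow> y \<in> L \<Longrightarrow> x - y \<in> L"
    and x: "\<And>i j. i \<in> {1..\<gamma>} \<Longrightarrow> j \<in> {1..n} \<Longrightarrow> x i j \<in> L"
  defines "N \<equiv> (\<Prod>i = 1..n. m i + 1) - 1"
  shows "\<exists>A \<in> carrier_mat N N.
    (\<forall>i<N. \<forall>j<N. A $$ (i, j) \<in> L) \<and> det A = multipermanent x \<gamma> n m" and "N > 0"
proof -
  \<comment> \<open>Extensional functions represent each tuple exactly once, so \<open>S\<close> has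
    the required cardinality.\<close>
  define S where "S = PiE {1..n} (\<lambda>j. {..m j})"
  define rank :: "(nat \<Rightarrow> nat) \<Rightarrow> nat" where "rank = (\<lambda>v. \<Sum>j = 1..n. v j)"
  define s :: "nat \<Rightarrow> nat" where "s = (\<lambda>j\<in>{1..n}. 0)"
  define t where "t = restrict m {1..n}"
  \<comment> \<open>The sum has at most one term, since \<open>u\<close> and \<open>v\<close>
    determine the raised coordinate \<open>k\<close>; the row index \<open>rank v\<close> equals
    \<open>rank u + 1\<close>.\<close>
  define W where "W = (\<lambda>u v. \<Sum>k \<in> {k \<in> {1..n}. v = u(k := Suc (u k))}. x (rank v) k)"
  \<comment> \<open>The path sums are given in closed form; their recursion is the expansion along
    the last row.\<close>
  define P where "P = (\<lambda>v. multipermanent x (rank v) n v)"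
  have rank_upd: "rank (u(k := Suc (u k))) = Suc (rank u)" if "k \<in> {1..n}" for u k
  proof -
    have "rank v = v k + sum v ({1..n} - {k})" for v :: "nat \<Rightarrow> nat"
      using that by (simp add: rank_def sum.remove)
    from this[of u] this[of "u(k := Suc (u k))"] show ?thesis
      by simp
  qed
  have S_iff: "v \<in> S \<longleftrightarrow> (\<forall>j\<in>{1..n}. v j \<le> m j) \<and> v \<in> extensional {1..n}" for v
    by (simp only: S_def PiE_iff atMost_iff)
  have S_ext: "v \<in> extensional {1..n}" if "v \<in> S - {w}" for v w
    using that by (simp only: S_iff Diff_iff)
  have fin: "finite S"
    by (simp add: S_def finite_PiE)
  have card: "card S = (\<Prod>i = 1..n. m i + 1)"
    by (simp add: S_def card_PiE)
  have sS: "s \<in> S" and tS: "t \<in> S"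
    by (auto simp: S_def s_def t_def)
  have rank_s: "rank s = 0" and rank_t: "rank t = \<gamma>"
    using comp by (simp_all add: rank_def s_def t_def composition_def)
  have s_min: "rank s < rank v" if v: "v \<in> S - {s}" for v
  proof (rule ccontr)
    assume "\<not> rank s < rank v"
    then have "\<forall>j\<in>{1..n}. v j = 0"
      by (simp add: rank_s) (simp add: rank_def)
    then have "v = s"
      using S_ext[OF v] by (intro extensionalityI[of _ "{1..n}"]) (simp_all add: s_def)
    then show False using v by simp
  qed
  have le: "v j \<le> m j" if "v \<in> S" "j \<in> {1..n}" for v j
    using that unfolding S_iff by blast
  have t_max: "rank v < rank t" if v: "v \<in> S - {t}" for v
  proof -
    have "\<exists>j\<in>{1..n}. v j \<noteq> m j"
    proof (rule ccontr)
      assume "\<not> ?thesis"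
      then have "v = t"
        using S_ext[OF v] by (intro extensionalityI[of _ "{1..n}"]) (simp_all add: t_def)
      then show False using v by simp
    qed
    then obtain j where j: "j \<in> {1..n}" "v j \<noteq> m j"
      by blast
    then have "v j < m j"
      using le[of v j] v by simp
    then have "rank v < sum m {1..n}"
      unfolding rank_def using le v j by (intro sum_strict_mono_ex1) auto
    then show ?thesis by (simp add: rank_def t_def)
  qed
  have W_rank: "rank u < rank v" if "W u v \<noteq> 0" for u v
  proof -
    have "{k \<in> {1..n}. v = u(k := Suc (u k))} \<noteq> {}"
      using that unfolding W_def by (rule contrapos_nn) (simp only: sum.empty)
    then show ?thesis using rank_upd by fastforce
  qed
  have P_s: "P s = 1"
    unfolding P_def rank_s by (rule multipermanent_0) (simp add: s_def)
  have P_rec: "P v = (\<Sum>u\<in>S. P u * W u v)" if v: "v \<in> S - {s}" for v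
  proof -
    obtain r where r: "rank v = Suc r"
      using s_min[OF v] by (cases "rank v") auto
    have "(\<Sum>u\<in>S. P u * W u v) =
        (\<Sum>u\<in>S. \<Sum>k\<in>{1..n}. if v = u(k := Suc (u k)) then P u * x (rank v) k else 0)"
      unfolding W_def sum_distrib_left by (simp only: sum.inter_filter[OF finite_atLeastAtMost])
    also have "\<dots> = (\<Sum>k\<in>{1..n}. \<Sum>u\<in>S. if v = u(k := Suc (u k)) then P u * x (rank v) k else 0)"
      by (rule sum.swap)
    also have "\<dots> = (\<Sum>k\<in>{1..n}. if v k > 0
        then multipermanent x r n (v(k := v k - 1)) * x (Suc r) k else 0)"
    proof (rule sum.cong[OF refl])
      fix k assume k: "k \<in> {1..n}"
      let ?u = "v(k := v k - 1)"
      \<comment> \<open>For fixed \<open>k\<close> there is at most one predecessor of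
        \<open>v\<close>, so the inner sum over \<open>u\<close> collapses.\<close>
      have "(v = u(k := Suc (u k))) = (v k > 0 \<and> u = ?u)" for u
      proof
        assume "v = u(k := Suc (u k))"
        then show "v k > 0 \<and> u = ?u" by simp
      next
        assume "v k > 0 \<and> u = ?u"
        then show "v = u(k := Suc (u k))" by simp
      qed
      then have "(\<Sum>u\<in>S. if v = u(k := Suc (u k)) then P u * x (rank v) k else 0) =
          (\<Sum>u\<in>S. if u = ?u then (if v k > 0 then P u * x (rank v) k else 0) else 0)"
        by (intro sum.cong) auto
      also have "\<dots> = (if v k > 0 then P ?u * x (rank v) k else 0)"
      proof -
        have "?u \<in> S"
          unfolding S_iff
        proof (intro conjI ballI)
          show "?u j \<le> m j" if "j \<in> {1..n}" for j
            using v le[OF _ that, of v] by auto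
          show "?u \<in> extensional {1..n}"
            using S_ext[OF v] k unfolding extensional_def by fastforce
        qed
        then show ?thesis using fin by simp
      qed
      also have "\<dots> = (if v k > 0 then multipermanent x r n ?u * x (Suc r) k else 0)"
        using rank_upd[OF k, of ?u] r by (auto simp: P_def)
      finally show "(\<Sum>u\<in>S. if v = u(k := Suc (u k)) then P u * x (rank v) k else 0) = \<dots>" .
    qed
    also have "\<dots> = P v"
      by (simp only: P_def r multipermanent_Suc sum.inter_filter[OF finite_atLeastAtMost])
    finally show ?thesis by simp
  qed
  \<comment> \<open>Written as \<open>y - (0 - z)\<close>.\<close>
  have L_add: "y + z \<in> L" if "y \<in> L" "z \<in> L" for y z
    using L(3)[OF that(1) L(3)[OF L(1) that(2)]] by simp
  have L_sum: "sum f K \<in> L" if "\<And>k. k \<in> K \<Longrightarrow> f k \<in> L" for f and K :: "nat set"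
    using that by (induction K rule: infinite_finite_induct) (auto intro: L(1) L_add)
  have W_L: "W u v \<in> L" if "u \<in> S" "v \<in> S" for u v
  proof -
    have "x (rank v) k \<in> L" if "k \<in> {k \<in> {1..n}. v = u(k := Suc (u k))}" for k
    proof -
      have "rank v = Suc (rank u)"
        using that rank_upd by auto
      \<comment> \<open>With \<open>rank v = Suc (rank u)\<close> this places the row index in
        \<open>{1..\<gamma>}\<close>, where the entries of \<open>x\<close> are known to lie in
        \<open>L\<close>.\<close>
      moreover have "rank v \<le> \<gamma>"
        using t_max[of v] \<open>v \<in> S\<close> rank_t by (cases "v = t") auto
      ultimately show ?thesis using that x by auto
    qed
    then show ?thesis
      unfolding W_def by (rule L_sum)
  qed
  have st: "s \<noteq> t"
    using rank_s rank_t pos by auto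
  have "\<exists>A \<in> carrier_mat (card S - 1) (card S - 1).
    (\<forall>i < card S - 1. \<forall>j < card S - 1. A $$ (i, j) \<in> L) \<and> det A = P t"
    by (rule determinant_of_acyclic_weights[where W = W and rank = rank, OF fin sS tS st s_min t_max
          W_rank P_s P_rec L W_L])
  moreover have "P t = multipermanent x \<gamma> n m"
    unfolding P_def rank_t multipermanent_def
    by (rule sum.cong) (auto intro!: mperm_maps_cong simp: t_def)
  ultimately show "\<exists>A \<in> carrier_mat N N.
    (\<forall>i<N. \<forall>j<N. A $$ (i, j) \<in> L) \<and> det A = multipermanent x \<gamma> n m"
    by (simp only: N_def card)
  \<comment> \<open>Yields the positive matrix size that \<open>dc\<close> demands.\<close>
  have "card {s, t} \<le> card S"
    using fin sS tS by (intro card_mono) auto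
  then show "N > 0"
    using st card by (simp add: N_def)
qed

section \<open>Affine linear polynomials and determinantal complexity\<close>

lemma Const_diff: "Const (a - b :: 'k :: field) = Const a - Const b"
  by (simp add: Const_def single_diff)

lemma affine_linear_Const: "affine_linear V (Const c)"
  unfolding affine_linear_def
  by (intro exI[of _ c] exI[of _ "\<lambda>_. 0"]) (simp add: Const_def)

lemma affine_linear_diff:
  assumes "affine_linear V p" "affine_linear V q"
  shows "affine_linear V (p - q)"
proof -
  obtain c a where p: "p = Const c + (\<Sum>v\<in>V. Const (a v) * Var v)"
    using assms(1) unfolding affine_linear_def by blast
  obtain d b where q: "q = Const d + (\<Sum>v\<in>V. Const (b v) * Var v)"
    using assms(2) unfolding affine_linear_def by blast
  have "p - q = Const (c - d) + (\<Sum>v\<in>V. Const (a v - b v) * Var v)"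
    by (simp add: p q Const_diff left_diff_distrib sum_subtractf)
  then show ?thesis
    unfolding affine_linear_def by (intro exI)
qed

lemma affine_linear_Var:
  assumes "finite V" "v \<in> V"
  shows "affine_linear V (Var v :: ('v, 'k :: field) mpoly)"
proof -
  have "(\<Sum>w\<in>V. Const (if w = v then 1 else 0) * Var w) =
      (\<Sum>w\<in>V. if w = v then Var w else 0 :: ('v, 'k) mpoly)"
    by (intro sum.cong) (auto simp: Const_def)
  then have "(Var v :: ('v, 'k) mpoly) = Const 0 + (\<Sum>w\<in>V. Const (if w = v then 1 else 0) * Var w)"
    using assms by (simp add: Const_def)
  then show ?thesis
    unfolding affine_linear_def by (intro exI)
qed

text \<open>As \<open>dc\<close> is an infimum, the one matrix obtained with \<open>L\<close> the
  set of affine linear polynomials suffices. Any affine linear entries are allowed, not just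
  variables.\<close>

lemma dc_multipermanent_le:
  assumes "\<gamma> > 0" "composition \<gamma> n m"
    and "\<And>i j. i \<in> {1..\<gamma>} \<Longrightarrow> j \<in> {1..n} \<Longrightarrow> affine_linear V (x i j)"
  shows "dc V (multipermanent x \<gamma> n m) \<le> enat ((\<Prod>i = 1..n. m i + 1) - 1)"
proof -
  have "0 \<in> Collect (affine_linear V)" "1 \<in> Collect (affine_linear V)"
    using affine_linear_Const[of V 0] affine_linear_Const[of V 1] by (simp_all add: Const_def)
  note * = determinant_of_multipermanent[OF assms(1,2) this, of x, unfolded mem_Collect_eq,
      OF affine_linear_diff assms(3)]
  then show ?thesis
    unfolding dc_def by (intro Inf_lower CollectI exI conjI) (rule refl, assumption+)
qed

section \<open>The two polynomials as multipermanents\<close>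

lemma mperm_eq_multipermanent: "mperm \<gamma> n m = multipermanent (\<lambda>i j. Var (i, j)) \<gamma> n m"
  by (simp add: mperm_def multipermanent_def)

text \<open>Singleton fibres make the map surjective, and a surjection of a finite set onto itself
  is injective.\<close>

lemma mem_mperm_maps_1_iff:
  "\<sigma> \<in> mperm_maps n n (\<lambda>_. 1) \<longleftrightarrow> \<sigma> \<in> extensional {1..n} \<and> bij_betw \<sigma> {1..n} {1..n}"
proof
  assume \<sigma>: "\<sigma> \<in> mperm_maps n n (\<lambda>_. 1)"
  have "j \<in> \<sigma> ` {1..n}" if "j \<in> {1..n}" for j
  proof -
    have "card {i \<in> {1..n}. \<sigma> i = j} = 1"
      using \<sigma> that by (simp add: mperm_maps_def)
    then obtain i where "{i \<in> {1..n}. \<sigma> i = j} = {i}"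
      using card_1_singletonE by blast
    then have "i \<in> {1..n}" "\<sigma> i = j"
      by blast+
    then show ?thesis by blast
  qed
  moreover have "\<sigma> \<in> {1..n} \<rightarrow>\<^sub>E {1..n}"
    using \<sigma> by (simp add: mperm_maps_def)
  ultimately have "\<sigma> ` {1..n} = {1..n}"
    by (fastforce simp: PiE_iff)
  with \<open>\<sigma> \<in> {1..n} \<rightarrow>\<^sub>E {1..n}\<close>
  show "\<sigma> \<in> extensional {1..n} \<and> bij_betw \<sigma> {1..n} {1..n}"
    by (simp add: PiE_iff bij_betw_def eq_card_imp_inj_on)
next
  assume \<sigma>: "\<sigma> \<in> extensional {1..n} \<and> bij_betw \<sigma> {1..n} {1..n}"
  have "card {i \<in> {1..n}. \<sigma> i = j} = 1" if j: "j \<in> {1..n}" for j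
  proof -
    have "j \<in> \<sigma> ` {1..n}"
      using \<sigma> j by (simp only: bij_betw_def)
    then obtain i where i: "i \<in> {1..n}" "\<sigma> i = j"
      by blast
    moreover have "inj_on \<sigma> {1..n}"
      using \<sigma> by (simp only: bij_betw_def)
    ultimately have "{i \<in> {1..n}. \<sigma> i = j} = {i}"
      by (blast dest: inj_onD)
    then show ?thesis by simp
  qed
  then show "\<sigma> \<in> mperm_maps n n (\<lambda>_. 1)"
    using \<sigma> bij_betw_imp_funcset[of \<sigma> "{1..n}" "{1..n}"]
    unfolding mperm_maps_def PiE_def by simp
qed

text \<open>The case of the ordinary permanent. The reindexing only changes the values outside
  \<open>{1..n}\<close>: undefined for extensional maps, the identity for permutations.\<close>

lemma multipermanent_1:
  "multipermanent x n n (\<lambda>_. 1) = (\<Sum>\<sigma> | \<sigma> permutes {1..n}. \<Prod>i = 1..n. x i (\<sigma> i))"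
  unfolding multipermanent_def
proof (rule sum.reindex_bij_witness[where
      i = "\<lambda>\<sigma>. restrict \<sigma> {1..n}" and j = "\<lambda>\<sigma> i. if i \<in> {1..n} then \<sigma> i else i"])
  fix \<sigma> assume "\<sigma> \<in> mperm_maps n n (\<lambda>_. 1)"
  then have \<sigma>: "\<sigma> \<in> extensional {1..n}" "bij_betw \<sigma> {1..n} {1..n}"
    by (simp_all only: mem_mperm_maps_1_iff)
  show "restrict (\<lambda>i. if i \<in> {1..n} then \<sigma> i else i) {1..n} = \<sigma>"
    using \<sigma>(1) by (auto simp: extensional_def fun_eq_iff)
  have "bij_betw (\<lambda>i. if i \<in> {1..n} then \<sigma> i else i) {1..n} {1..n}"
    using \<sigma>(2) by (rule bij_betw_cong[THEN iffD1, rotated]) simp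
  then show "(\<lambda>i. if i \<in> {1..n} then \<sigma> i else i) \<in> {\<sigma>. \<sigma> permutes {1..n}}"
    unfolding mem_Collect_eq by (rule bij_imp_permutes) auto
  show "(\<Prod>i = 1..n. x i (if i \<in> {1..n} then \<sigma> i else i)) = (\<Prod>i = 1..n. x i (\<sigma> i))"
    by (intro prod.cong) auto
next
  fix \<sigma> assume "\<sigma> \<in> {\<sigma>. \<sigma> permutes {1..n}}"
  then have \<sigma>: "\<sigma> permutes {1..n}" by simp
  show "(\<lambda>i. if i \<in> {1..n} then restrict \<sigma> {1..n} i else i) = \<sigma>"
    using permutes_not_in[OF \<sigma>] by (auto simp: fun_eq_iff)
  show "restrict \<sigma> {1..n} \<in> mperm_maps n n (\<lambda>_. 1)"
    using permutes_imp_bij[OF \<sigma>] unfolding mem_mperm_maps_1_iff by simp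
qed

text \<open>The signs are chosen independently in each row, so by distributivity the sum over them
  factors into a product of two-term sums.\<close>

lemma hoperm_eq_multipermanent:
  "(hoperm n :: (nat \<times> int, 'k :: field) mpoly) =
    multipermanent (\<lambda>i j. Var (i, int j) + Var (i, - int j)) n n (\<lambda>_. 1)"
proof -
  have "(\<Sum>\<epsilon> \<in> {1..n} \<rightarrow>\<^sub>E {1, - 1}. \<Prod>i = 1..n. Var (i, \<epsilon> i * int (\<sigma> i)) :: (nat \<times> int, 'k) mpoly) =
    (\<Prod>i = 1..n. \<Sum>e \<in> {1, - 1}. Var (i, e * int (\<sigma> i)))" for \<sigma>
    by (rule prod_sum_PiE[symmetric]) auto
  then show ?thesis
    by (simp add: hoperm_def multipermanent_1 del: One_nat_def)
qed

theorem theorem1p3: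
  "(\<forall>n. n > 0 \<longrightarrow>
      dc (hoperm_vars n) (hoperm n :: (nat \<times> int, 'k :: field) mpoly) \<le> enat (3 ^ n)) \<and>
   (\<forall>\<gamma> n m. \<gamma> > 0 \<and> composition \<gamma> n m \<longrightarrow>
      dc (mperm_vars \<gamma> n) (mperm \<gamma> n m :: (nat \<times> nat, 'k) mpoly)
        \<le> enat ((\<Prod>i = 1..n. (m i + 1)) - 1))"
proof (intro conjI allI impI)
  fix n :: nat assume n: "n > 0"
  have fin: "finite (hoperm_vars n)"
    by (simp add: hoperm_vars_def)
  have "affine_linear (hoperm_vars n) (Var (i, int j) + Var (i, - int j) :: (nat \<times> int, 'k) mpoly)"
    if "i \<in> {1..n}" "j \<in> {1..n}" for i j
  proof -
    have "affine_linear (hoperm_vars n) (Var (i, int j) :: (nat \<times> int, 'k) mpoly)"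
      "affine_linear (hoperm_vars n) (Var (i, - int j) :: (nat \<times> int, 'k) mpoly)"
      using that by (auto intro!: affine_linear_Var fin simp: hoperm_vars_def)
    \<comment> \<open>The sum is obtained from closure under differences, as
      \<open>p - (0 - q)\<close>.\<close>
    from affine_linear_diff[OF this(1) affine_linear_diff[OF affine_linear_Const[of _ 0] this(2)]]
    show ?thesis by (simp add: Const_def)
  qed
  then have "dc (hoperm_vars n) (hoperm n :: (nat \<times> int, 'k) mpoly)
      \<le> enat ((\<Prod>i = 1..n. 1 + 1) - 1)"
    unfolding hoperm_eq_multipermanent
    by (intro dc_multipermanent_le) (auto simp: n composition_def)
  \<comment> \<open>The left side is \<open>2 ^ n - 1\<close>, the bound for the composition of
    \<open>n\<close> into ones.\<close>
  also have "(\<Prod>i = 1..n. 1 + 1) - 1 \<le> (3 :: nat) ^ n"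
    using power_mono[of "2 :: nat" 3 n] by (simp add: numeral_2_eq_2)
  finally show "dc (hoperm_vars n) (hoperm n :: (nat \<times> int, 'k) mpoly) \<le> enat (3 ^ n)"
    by simp
next
  fix \<gamma> n m assume "\<gamma> > 0 \<and> composition \<gamma> n m"
  then show "dc (mperm_vars \<gamma> n) (mperm \<gamma> n m :: (nat \<times> nat, 'k) mpoly)
        \<le> enat ((\<Prod>i = 1..n. (m i + 1)) - 1)"
    unfolding mperm_eq_multipermanent
    by (intro dc_multipermanent_le affine_linear_Var) (auto simp: mperm_vars_def)
qed

end
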